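(* Let $c:I\to\mathbb R^3$ be a planar perpendicular symmetric curve and let $X=\mathfrak B(c)$ be its Björling transformation. Then $\hat c(t)=X(it)$, $t\in I$, is a (planar) perpendicular symmetric curve. Moreover, if $c$ is non-degenerate, then $\hat c$ is non-degenerate.
   Context: Identify $\mathbb R^2\cong\mathbb C$, $w=u+iv$. $I\subset\mathbb R$ is an open interval symmetric about $0$, and $\Omega\subset\mathbb C$ is a simply connected domain containing $I$, invariant under $w\mapsto\bar w$ and $w\mapsto iw$, to which $c$ and its normal extend holomorphically. Björling transformation. Let $c$ be a regular real analytic curve contained in a plane of $\mathbb R^3$, and let $n$ be its unit real analytic principal normal field in that plane. Then $$\mathfrak B(c)(w)=\Re\Big(c(w)-i\int_{0}^{w} n(z)\times c'(z)\,dz\Big),\qquad w\in\Omega,$$ where $c(w),n(w)$ denote the holomorphic extensions; this is the minimal surface $X:\Omega\to\mathbb R^3$ with $X(t)=c(t)$ and unit normal $n(t)$ along $c$. Perpendicular symmetric curve. A planar curve $c$ is perpendicular symmetric with respect to a line $\mathscr L$ of its plane (with direction vector $a\neq0$) if $c$ is symmetric under reflection in $\mathscr L$ and there is $t_0$ with $c(t_0)\in\mathscr L$ and $\langle\dot c(t_0),a\rangle=0$; the point $c(t_0)$ is the symmetry vertex. It is non-degenerate if its principal normal (curvature vector) does not vanish at the symmetry vertex. The parameter is chosen so that $t_0=0$ and the reflection in $\mathscr L$ sends $c(t)$ to $c(-t)$. *)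

theory Defs
  imports "HOL-Complex_Analysis.Complex_Analysis"
begin

definition real_analytic_on :: "real set \<Rightarrow> (real \<Rightarrow> 'a::real_normed_vector) \<Rightarrow> bool" where
  "real_analytic_on I f \<longleftrightarrow>
     (\<forall>t0\<in>I. \<exists>r>0. \<exists>a. \<forall>t. \<bar>t - t0\<bar> < r \<longrightarrow> (\<lambda>k. (t - t0) ^ k *\<^sub>R a k) sums f t)"

definition regular_on :: "real set \<Rightarrow> (real \<Rightarrow> real^3) \<Rightarrow> bool" where
  "regular_on I c \<longleftrightarrow> (\<forall>t\<in>I. vector_derivative c (at t) \<noteq> 0)"

definition planar_curve :: "real set \<Rightarrow> (real^3) set \<Rightarrow> (real \<Rightarrow> real^3) \<Rightarrow> bool" where
  "planar_curve I P c \<longleftrightarrow> real_analytic_on I c \<and> affine P \<and> aff_dim P = 2 \<and> c ` I \<subseteq> P"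

definition line_through :: "real^3 \<Rightarrow> real^3 \<Rightarrow> (real^3) set" where
  "line_through p a = {p + s *\<^sub>R a | s. True}"

(* On a plane containing the line this is the reflection of that plane in the line. *)
definition reflect_in_line :: "real^3 \<Rightarrow> real^3 \<Rightarrow> real^3 \<Rightarrow> real^3" where
  "reflect_in_line p a x = p + (2 * ((x - p) \<bullet> a) / (a \<bullet> a)) *\<^sub>R a - (x - p)"

(* c is a curve in the plane P which is perpendicular symmetric with respect to the line
   through p with direction a, parametrized so that the symmetry vertex is c 0 and the
   reflection sends c t to c (- t). *)
definition perp_symmetric ::
    "real set \<Rightarrow> (real^3) set \<Rightarrow> real^3 \<Rightarrow> real^3 \<Rightarrow> (real \<Rightarrow> real^3) \<Rightarrow> bool" where
  "perp_symmetric I P p a c \<longleftrightarrow>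
     planar_curve I P c \<and> a \<noteq> 0 \<and> line_through p a \<subseteq> P \<and>
     (\<forall>t\<in>I. reflect_in_line p a (c t) = c (- t)) \<and>
     0 \<in> I \<and> c 0 \<in> line_through p a \<and> vector_derivative c (at 0) \<bullet> a = 0"

(* Arc-length derivative of the unit tangent, for an arbitrary regular parametrization. *)
definition curvature_vector :: "(real \<Rightarrow> real^3) \<Rightarrow> real \<Rightarrow> real^3" where
  "curvature_vector c t =
     vector_derivative (\<lambda>s. sgn (vector_derivative c (at s))) (at t)
       /\<^sub>R norm (vector_derivative c (at t))"

definition nondegenerate :: "(real \<Rightarrow> real^3) \<Rightarrow> bool" where
  "nondegenerate c \<longleftrightarrow> curvature_vector c 0 \<noteq> 0"

(* Analytic unit field normal to c inside the plane P.  The curvature vector is a multiple of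
   n, but of unrestricted sign: the normalized curvature vector need not be defined at an
   inflection point, nor extend continuously across it.  The condition x + n t : P for x : P
   says that n t is a direction vector of P. *)
definition unit_principal_normal ::
    "real set \<Rightarrow> (real^3) set \<Rightarrow> (real \<Rightarrow> real^3) \<Rightarrow> (real \<Rightarrow> real^3) \<Rightarrow> bool" where
  "unit_principal_normal I P c n \<longleftrightarrow>
     real_analytic_on I n \<and>
     (\<forall>t\<in>I. norm (n t) = 1 \<and> (\<forall>x\<in>P. x + n t \<in> P) \<and>
            n t \<bullet> vector_derivative c (at t) = 0 \<and>
            curvature_vector c t \<in> span {n t})"

definition holomorphic_extension ::
    "real set \<Rightarrow> complex set \<Rightarrow> (real \<Rightarrow> real^3) \<Rightarrow> (complex \<Rightarrow> complex^3) \<Rightarrow> bool" where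
  "holomorphic_extension I \<Omega> f F \<longleftrightarrow>
     (\<forall>j. (\<lambda>w. F w $ j) holomorphic_on \<Omega>) \<and>
     (\<forall>t\<in>I. \<forall>j. F (complex_of_real t) $ j = complex_of_real (f t $ j))"

definition deriv_vec :: "(complex \<Rightarrow> complex^3) \<Rightarrow> complex \<Rightarrow> complex^3" where
  "deriv_vec F z = (\<chi> j. deriv (\<lambda>w. F w $ j) z)"

(* The complex-bilinear extension of the cross product cross3 on real^3. *)
definition cross3_complex :: "complex^3 \<Rightarrow> complex^3 \<Rightarrow> complex^3" where
  "cross3_complex a b =
     vector [a$2 * b$3 - a$3 * b$2, a$3 * b$1 - a$1 * b$3, a$1 * b$2 - a$2 * b$1]"

(* The integral from 0 to w along some path in the domain.  On a simply connected domain
   containing 0 it does not depend on the path; see integral_from_0_eq. *)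
definition integral_from_0 :: "complex set \<Rightarrow> (complex \<Rightarrow> complex) \<Rightarrow> complex \<Rightarrow> complex" where
  "integral_from_0 \<Omega> f w =
     contour_integral
       (SOME \<gamma>. valid_path \<gamma> \<and> path_image \<gamma> \<subseteq> \<Omega> \<and> pathstart \<gamma> = 0 \<and> pathfinish \<gamma> = w) f"

lemma integral_from_0_eq:
  assumes "open \<Omega>" "simply_connected \<Omega>" "f holomorphic_on \<Omega>"
    and \<gamma>: "valid_path \<gamma>" "path_image \<gamma> \<subseteq> \<Omega>" "pathstart \<gamma> = 0" "pathfinish \<gamma> = w"
  shows "integral_from_0 \<Omega> f w = contour_integral \<gamma> f"
proof -
  let ?P = "\<lambda>\<gamma>. valid_path \<gamma> \<and> path_image \<gamma> \<subseteq> \<Omega> \<and> pathstart \<gamma> = 0 \<and> pathfinish \<gamma> = w"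
  define g where "g = (SOME \<gamma>. ?P \<gamma>)"
  have g: "?P g"
    unfolding g_def by (rule someI[of ?P \<gamma>]) (use \<gamma> in auto)
  have "(f has_contour_integral 0) (g +++ reversepath \<gamma>)"
    using assms g by (intro Cauchy_theorem_simply_connected[of \<Omega>])
      (auto intro!: valid_path_join simp: path_image_join)
  then have "contour_integral (g +++ reversepath \<gamma>) f = 0"
    by (rule contour_integral_unique)
  moreover have "f contour_integrable_on g" "f contour_integrable_on \<gamma>"
    using assms g by (auto intro!: contour_integrable_holomorphic_simple)
  ultimately have "contour_integral g f = contour_integral \<gamma> f"
    using g \<gamma> by (simp add: contour_integral_join contour_integral_reversepath
        contour_integrable_reversepath)
  then show ?thesis by (simp add: integral_from_0_def g_def)
qed

(* C and N are the holomorphic extensions of the curve and of its normal. *)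
definition bjoerling ::
    "complex set \<Rightarrow> (complex \<Rightarrow> complex^3) \<Rightarrow> (complex \<Rightarrow> complex^3) \<Rightarrow> complex \<Rightarrow> real^3" where
  "bjoerling \<Omega> C N w =
     (\<chi> j. Re (C w $ j - \<i> * integral_from_0 \<Omega> (\<lambda>z. cross3_complex (N z) (deriv_vec C z) $ j) w))"

(* Differential of X (over the reals) injective at w, i.e. no branch point at w. *)
definition immersed_at :: "(complex \<Rightarrow> real^3) \<Rightarrow> complex \<Rightarrow> bool" where
  "immersed_at X w \<longleftrightarrow> X differentiable (at w) \<and> inj (frechet_derivative X (at w))"

end

theory Submission
  imports Defs
begin

text \<open>
  Write \<open>X = Re (C - i G)\<close>, where \<open>G\<close> is the primitive of \<open>n \<times> c'\<close> vanishing at \<open>0\<close>.  By the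
  identity theorem \<open>C(- w)\<close> is the reflection of \<open>C(w)\<close>, while \<open>C\<close> commutes with conjugation, so
  \<open>Re C(it)\<close> is fixed by the reflection, i.e. lies on the line.  The product \<open>n \<times> c'\<close> is an even
  multiple of the normal of the plane of \<open>c\<close>; hence \<open>G\<close> is odd and orthogonal to that plane.  So the
  new curve lies in the plane spanned by the line and this normal, and is symmetric in the same
  line.  At the vertex its velocity is \<open>n \<times> c'\<close> and its acceleration is \<open>- c''\<close>, and both \<open>c''\<close> and
  \<open>- c''\<close> are orthogonal to the respective velocity there, so the curvature vectors vanish
  simultaneously.
\<close>

no_notation fps_nth (infixl \<open>$\<close> 75)

section \<open>Real parts of holomorphic curves along rays through the origin\<close>

definition Re_vec :: "complex^3 \<Rightarrow> real^3" where
  "Re_vec z = (\<chi> j. Re (z $ j))"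

lemma Re_vec_nth [simp]: "Re_vec z $ j = Re (z $ j)"
  by (simp add: Re_vec_def)

lemma has_vector_derivative_vecI:
  fixes f :: "real \<Rightarrow> real^'n"
  assumes "\<And>j. ((\<lambda>t. f t $ j) has_vector_derivative d $ j) (at t)"
  shows "(f has_vector_derivative d) (at t)"
  unfolding has_vector_derivative_def
proof (subst has_derivative_componentwise_within, intro ballI)
  fix e :: "real^'n"
  assume "e \<in> Basis"
  then obtain j where e: "e = axis j 1"
    by (auto simp: Basis_vec_def)
  show "((\<lambda>x. f x \<bullet> e) has_derivative (\<lambda>x. (x *\<^sub>R d) \<bullet> e)) (at t)"
    using assms[of j] by (simp add: e inner_axis has_vector_derivative_def)
qed

lemma has_vector_derivative_compose_uminus:
  assumes "(f has_vector_derivative d) (at (- t))"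
  shows "((f \<circ> uminus) has_vector_derivative - d) (at t)"
  using vector_diff_chain_at[OF has_vector_derivative_minus[OF has_vector_derivative_id] assms]
  by (simp add: o_def)

text \<open>Chain rule along the ray with direction \<open>u\<close>. It is used with
  \<open>u = 1\<close> for the given curve and with \<open>u = \<i>\<close> for the new one.\<close>

lemma has_vector_derivative_Re_vec_ray:
  assumes "open \<Omega>" and hol: "\<And>j. (\<lambda>w. F w $ j) holomorphic_on \<Omega>"
    and mem: "u * complex_of_real t \<in> \<Omega>"
  shows "((\<lambda>t. Re_vec (F (u * complex_of_real t))) has_vector_derivative
           Re_vec (\<chi> j. u * deriv_vec F (u * complex_of_real t) $ j)) (at t)"
proof (rule has_vector_derivative_vecI)
  fix j
  have D: "((\<lambda>w. F w $ j) has_field_derivative deriv (\<lambda>w. F w $ j) (u * of_real t))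
      (at (u * complex_of_real t))"
    using holomorphic_derivI[OF hol \<open>open \<Omega>\<close> mem] .
  have "((\<lambda>t. u * complex_of_real t) has_vector_derivative u) (at t)"
    by (auto intro!: derivative_eq_intros)
  from field_vector_diff_chain_at[OF this D]
  have "((\<lambda>t. F (u * of_real t) $ j) has_vector_derivative
      u * deriv (\<lambda>w. F w $ j) (u * of_real t)) (at t)"
    by (simp add: o_def)
  from bounded_linear.has_vector_derivative[OF bounded_linear_Re this]
  show "((\<lambda>t. Re_vec (F (u * complex_of_real t)) $ j) has_vector_derivative
      Re_vec (\<chi> j. u * deriv_vec F (u * complex_of_real t) $ j) $ j) (at t)"
    by (simp add: deriv_vec_def)
qed

text \<open>The coefficients are the real parts of the complex Taylor coefficients at the point of
  the ray, with \<open>u ^ k\<close> absorbed. Since \<open>u\<close> has modulus 1, distances along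
  the ray equal distances of parameters, so the radius of a disc in the domain serves
  unchanged.\<close>

lemma real_analytic_on_Re_vec_ray:
  assumes "open \<Omega>" and hol: "\<And>j. (\<lambda>w. F w $ j) holomorphic_on \<Omega>"
    and u: "norm u = 1" and mem: "\<And>t. t \<in> I \<Longrightarrow> u * complex_of_real t \<in> \<Omega>"
  shows "real_analytic_on I (\<lambda>t. Re_vec (F (u * complex_of_real t)))"
  unfolding real_analytic_on_def
proof
  fix t0 assume "t0 \<in> I"
  let ?z = "u * complex_of_real t0"
  obtain r where r: "r > 0" "ball ?z r \<subseteq> \<Omega>"
    using \<open>open \<Omega>\<close> mem[OF \<open>t0 \<in> I\<close>] open_contains_ball by blast
  define a where "a k = Re_vec (\<chi> j. (deriv ^^ k) (\<lambda>w. F w $ j) ?z / fact k * u ^ k)" for k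
  have "(\<lambda>k. (t - t0) ^ k *\<^sub>R a k) sums Re_vec (F (u * complex_of_real t))"
    if t: "\<bar>t - t0\<bar> < r" for t
    unfolding sums_def
  proof (rule vec_tendstoI)
    fix j
    have diff: "u * of_real t - ?z = u * of_real (t - t0)"
      by (simp add: algebra_simps)
    have "norm (u * of_real t - ?z) = \<bar>t - t0\<bar>"
      unfolding diff norm_mult u norm_of_real by simp
    then have "dist ?z (u * of_real t) = \<bar>t - t0\<bar>"
      by (simp add: dist_norm norm_minus_commute)
    then have "u * of_real t \<in> ball ?z r"
      using t by simp
    then have "(\<lambda>k. (deriv ^^ k) (\<lambda>w. F w $ j) ?z / fact k * (u * of_real t - ?z) ^ k)
        sums F (u * of_real t) $ j"
      by (rule holomorphic_power_series[OF holomorphic_on_subset[OF hol r(2)]])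
    then have "(\<lambda>k. Re ((deriv ^^ k) (\<lambda>w. F w $ j) ?z / fact k * (u * of_real t - ?z) ^ k))
        sums Re (F (u * of_real t) $ j)"
      by (rule sums_Re)
    moreover have "Re ((deriv ^^ k) (\<lambda>w. F w $ j) ?z / fact k * (u * of_real t - ?z) ^ k)
        = ((t - t0) ^ k *\<^sub>R a k) $ j" for k
    proof -
      have "(deriv ^^ k) (\<lambda>w. F w $ j) ?z / fact k * (u * of_real t - ?z) ^ k
          = of_real ((t - t0) ^ k) * ((deriv ^^ k) (\<lambda>w. F w $ j) ?z / fact k * u ^ k)"
        unfolding diff power_mult_distrib by simp
      then show ?thesis
        by (simp only: a_def Re_vec_nth vec_lambda_beta vector_scaleR_component
            times_complex.sel(1) Re_complex_of_real Im_complex_of_real) simp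
    qed
    ultimately show "(\<lambda>n. (\<Sum>k<n. (t - t0) ^ k *\<^sub>R a k) $ j)
        \<longlonglongrightarrow> Re_vec (F (u * of_real t)) $ j"
      by (simp add: sums_def sum_component)
  qed
  with r(1) show "\<exists>r>0. \<exists>a. \<forall>t. \<bar>t - t0\<bar> < r \<longrightarrow>
      (\<lambda>k. (t - t0) ^ k *\<^sub>R a k) sums Re_vec (F (u * complex_of_real t))"
    by blast
qed

section \<open>The path integral as a holomorphic primitive\<close>

text \<open>Simple connectedness yields some global primitive \<open>h\<close>; integrating along a
  path from 0 identifies the integral with \<open>h - h 0\<close>.\<close>

lemma integral_from_0_primitive:
  assumes "open \<Omega>" "simply_connected \<Omega>" "0 \<in> \<Omega>" "f holomorphic_on \<Omega>"
  shows "integral_from_0 \<Omega> f 0 = 0"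
    and "w \<in> \<Omega> \<Longrightarrow> (integral_from_0 \<Omega> f has_field_derivative f w) (at w)"
proof -
  obtain h where h: "\<And>z. z \<in> \<Omega> \<Longrightarrow> (h has_field_derivative f z) (at z)"
    using assms simply_connected_eq_global_primitive[of \<Omega>] by blast
  have eq: "h z - h 0 = integral_from_0 \<Omega> f z" if z: "z \<in> \<Omega>" for z
  proof -
    obtain \<gamma> where \<gamma>: "polynomial_function \<gamma>" "path_image \<gamma> \<subseteq> \<Omega>" "pathstart \<gamma> = 0" "pathfinish \<gamma> = z"
      using connected_open_polynomial_connected[of \<Omega> 0 z] assms z simply_connected_imp_connected
      by blast
    have valid: "valid_path \<gamma>"
      using \<gamma>(1) by (rule valid_path_polynomial_function)
    have "(f has_contour_integral (h (pathfinish \<gamma>) - h (pathstart \<gamma>))) \<gamma>"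
      by (rule contour_integral_primitive[OF _ valid \<gamma>(2)])
        (use h has_field_derivative_at_within in blast)
    then show ?thesis
      using integral_from_0_eq[OF assms(1,2,4) valid \<gamma>(2-4)] contour_integral_unique \<gamma>(3,4)
      by metis
  qed
  show "integral_from_0 \<Omega> f 0 = 0"
    using eq[OF \<open>0 \<in> \<Omega>\<close>] by simp
  show "(integral_from_0 \<Omega> f has_field_derivative f w) (at w)" if w: "w \<in> \<Omega>"
  proof (rule has_field_derivative_transform_within_open[OF _ \<open>open \<Omega>\<close> w eq])
    show "((\<lambda>z. h z - h 0) has_field_derivative f w) (at w)"
      using h[OF w] by (auto intro!: derivative_eq_intros)
  qed
qed

section \<open>Curvature at a point where velocity and acceleration are orthogonal\<close>

text \<open>Orthogonality makes the speed stationary at \<open>t\<close>, so differentiating the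
  unit tangent only rescales the acceleration; the second factor of the speed comes from passing to
  arc length.\<close>

lemma curvature_vector_eq:
  assumes "open S" "t \<in> S"
    and f': "\<And>s. s \<in> S \<Longrightarrow> (f has_vector_derivative f' s) (at s)"
    and f'': "(f' has_vector_derivative d) (at t)"
    and "f' t \<noteq> 0" "f' t \<bullet> d = 0"
  shows "curvature_vector f t = d /\<^sub>R (norm (f' t))\<^sup>2"
proof -
  have vd: "vector_derivative f (at s) = f' s" if "s \<in> S" for s
    using f'[OF that] by (rule vector_derivative_at)
  have D: "(f' has_derivative (\<lambda>h. h *\<^sub>R d)) (at t)"
    using f'' by (simp add: has_vector_derivative_def)
  have "((\<lambda>s. norm (f' s)) has_derivative (\<lambda>h. (h *\<^sub>R d) \<bullet> sgn (f' t))) (at t)"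
    by (rule has_derivative_compose[OF D has_derivative_norm[OF \<open>f' t \<noteq> 0\<close>]])
  then have "((\<lambda>s. norm (f' s)) has_derivative (\<lambda>h. 0)) (at t)"
    using \<open>f' t \<bullet> d = 0\<close> by (simp add: sgn_div_norm inner_commute)
  then have "((\<lambda>s. inverse (norm (f' s))) has_derivative (\<lambda>h. 0)) (at t)"
    using Deriv.has_derivative_inverse[where f = "\<lambda>s. norm (f' s)" and x = t and f' = "\<lambda>h. 0"]
      \<open>f' t \<noteq> 0\<close> by simp
  from has_derivative_scaleR[OF this D]
  have "((\<lambda>s. sgn (f' s)) has_vector_derivative d /\<^sub>R norm (f' t)) (at t)"
    by (simp add: sgn_div_norm has_vector_derivative_def mult.commute)
  then have "((\<lambda>s. sgn (vector_derivative f (at s))) has_vector_derivative d /\<^sub>R norm (f' t)) (at t)"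
    by (rule has_vector_derivative_transform_within_open[OF _ \<open>open S\<close> \<open>t \<in> S\<close>]) (simp add: vd)
  from vector_derivative_at[OF this] show ?thesis
    by (simp add: curvature_vector_def vd[OF \<open>t \<in> S\<close>] power2_eq_square)
qed

section \<open>Reflection in a line and its linear part\<close>

text \<open>For nonzero \<open>a\<close> this is the rotation of space by the angle pi about the
  axis \<open>a\<close>. It induces the reflection in the line on every plane through that line,
  hence on the old and the new plane alike.\<close>

definition half_turn :: "real^3 \<Rightarrow> real^3 \<Rightarrow> real^3" where
  "half_turn a x = (2 * (x \<bullet> a) / (a \<bullet> a)) *\<^sub>R a - x"

lemma reflect_in_line_eq: "reflect_in_line p a x = p + half_turn a (x - p)"
  by (simp add: reflect_in_line_def half_turn_def)

lemma bounded_linear_half_turn: "bounded_linear (half_turn a)"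
proof -
  have "half_turn a = (\<lambda>x. (2 / (a \<bullet> a)) *\<^sub>R ((x \<bullet> a) *\<^sub>R a) - x)"
    by (auto simp: half_turn_def)
  moreover have "bounded_linear (\<lambda>x. (2 / (a \<bullet> a)) *\<^sub>R ((x \<bullet> a) *\<^sub>R a) - x)"
    by (intro bounded_linear_sub bounded_linear_const_scaleR bounded_linear_scaleR_const
        bounded_linear_inner_left bounded_linear_ident)
  ultimately show ?thesis
    by simp
qed

lemma norm_half_turn: "norm (half_turn a x) = norm x"
proof (cases "a = 0")
  case False
  then have "a \<bullet> a \<noteq> 0"
    by simp
  then have "half_turn a x \<bullet> half_turn a x = x \<bullet> x"
    by (simp add: half_turn_def inner_diff_left inner_diff_right inner_commute field_simps)
  then show ?thesis
    by (simp add: norm_eq_sqrt_inner)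
qed (simp add: half_turn_def)

lemma half_turn_orthogonal: "x \<bullet> a = 0 \<Longrightarrow> half_turn a x = - x"
  by (simp add: half_turn_def)

lemma half_turn_fixed:
  assumes "half_turn a x = x"
  shows "x = ((x \<bullet> a) / (a \<bullet> a)) *\<^sub>R a"
proof -
  have "2 *\<^sub>R x = 2 *\<^sub>R (((x \<bullet> a) / (a \<bullet> a)) *\<^sub>R a)"
    using assms by (simp add: half_turn_def scaleR_2 algebra_simps)
  then show ?thesis
    by (simp only: scaleR_cancel_left) simp
qed

lemma reflect_in_line_fixed: "reflect_in_line p a x = x \<Longrightarrow> x \<in> line_through p a"
  using half_turn_fixed[of a "x - p"]
  by (auto simp: reflect_in_line_eq line_through_def algebra_simps
      intro!: exI[of _ "((x - p) \<bullet> a) / (a \<bullet> a)"])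

section \<open>Standing hypotheses, symmetries of the domain and the identity theorem\<close>

locale bjoerling_setting =
  fixes I :: "real set" and \<Omega> :: "complex set"
    and P :: "(real^3) set" and p a :: "real^3"
    and c n :: "real \<Rightarrow> real^3"
    and C N :: "complex \<Rightarrow> complex^3"
  assumes open_I: "open I" and interval_I: "is_interval I" and minus_image_I: "uminus ` I = I"
    and open_dom: "open \<Omega>" and simply_connected_dom: "simply_connected \<Omega>"
    and of_real_I: "complex_of_real ` I \<subseteq> \<Omega>"
    and cnj_image_dom: "cnj ` \<Omega> = \<Omega>" and ii_image_dom: "(\<lambda>w. \<i> * w) ` \<Omega> = \<Omega>"
    and perp: "perp_symmetric I P p a c" and regular: "regular_on I c"
    and normal: "unit_principal_normal I P c n"
    and ext_C: "holomorphic_extension I \<Omega> c C" and ext_N: "holomorphic_extension I \<Omega> n N"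
begin

lemma zero_I: "0 \<in> I"
  using perp by (simp add: perp_symmetric_def)

lemma minus_I: "t \<in> I \<Longrightarrow> - t \<in> I"
  using minus_image_I by blast

lemma of_real_dom: "t \<in> I \<Longrightarrow> complex_of_real t \<in> \<Omega>"
  using of_real_I by blast

lemma zero_dom: "0 \<in> \<Omega>"
  using of_real_dom[OF zero_I] by simp

lemma ii_mult_dom: "w \<in> \<Omega> \<Longrightarrow> \<i> * w \<in> \<Omega>"
  using ii_image_dom by blast

lemma ii_dom: "t \<in> I \<Longrightarrow> \<i> * complex_of_real t \<in> \<Omega>"
  by (intro ii_mult_dom of_real_dom)

lemma minus_dom: "w \<in> \<Omega> \<Longrightarrow> - w \<in> \<Omega>"
  using ii_mult_dom[OF ii_mult_dom[of w]] by simp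

lemma connected_dom: "connected \<Omega>"
  using simply_connected_dom by (rule simply_connected_imp_connected)

lemma holomorphic_on_minus:
  assumes "f holomorphic_on \<Omega>"
  shows "(\<lambda>w. f (- w)) holomorphic_on \<Omega>"
proof -
  have "f \<circ> uminus holomorphic_on \<Omega>"
    by (rule holomorphic_on_compose_gen[OF _ assms])
      (auto intro!: holomorphic_intros minus_dom)
  then show ?thesis
    by (simp add: o_def)
qed

text \<open>Carries symmetries of the curve from the real interval to the whole domain: 0 is a limit
  point of the interval, and the domain is connected.\<close>

lemma identity_theorem:
  assumes "f holomorphic_on \<Omega>" "h holomorphic_on \<Omega>"
    and eq: "\<And>t. t \<in> I \<Longrightarrow> f (complex_of_real t) = h (complex_of_real t)"
    and "w \<in> \<Omega>"
  shows "f w = h w"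
proof -
  obtain e where e: "e > 0" "ball 0 e \<subseteq> I"
    using open_I zero_I open_contains_ball by blast
  have lim: "(0::complex) islimpt complex_of_real ` I"
    unfolding islimpt_approachable
  proof (intro allI impI)
    fix d :: real assume "d > 0"
    then show "\<exists>x'\<in>complex_of_real ` I. x' \<noteq> 0 \<and> dist x' 0 < d"
      \<comment> \<open>Halving the smaller radius gives a nonzero point that is strictly closer
        than \<open>d\<close> and still inside the interval.\<close>
      using e by (intro bexI[of _ "complex_of_real (min d e / 2)"] imageI) auto
  qed
  have "(\<lambda>w. f w - h w) w = 0"
    by (rule analytic_continuation[OF _ open_dom connected_dom of_real_I zero_dom lim])
      (use assms in \<open>auto intro!: holomorphic_intros\<close>)
  then show ?thesis
    by simp
qed

text \<open>The complex derivative may be computed along the real axis, where the imaginary part is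
  constantly 0.\<close>

lemma Im_deriv_eq_0:
  assumes "f holomorphic_on \<Omega>" and real: "\<And>t. t \<in> I \<Longrightarrow> Im (f (complex_of_real t)) = 0"
    and "t \<in> I"
  shows "Im (deriv f (complex_of_real t)) = 0"
proof -
  have "((\<lambda>t. complex_of_real t) has_vector_derivative 1) (at t)"
    by (auto intro!: derivative_eq_intros)
  from field_vector_diff_chain_at[OF this
      holomorphic_derivI[OF assms(1) open_dom of_real_dom[OF \<open>t \<in> I\<close>]]]
  have "((\<lambda>t. f (complex_of_real t)) has_vector_derivative deriv f (complex_of_real t)) (at t)"
    by (simp add: o_def)
  from bounded_linear.has_vector_derivative[OF bounded_linear_Im this]
  have "((\<lambda>t. 0) has_vector_derivative Im (deriv f (complex_of_real t))) (at t)"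
    by (rule has_vector_derivative_transform_within_open[OF _ open_I \<open>t \<in> I\<close>]) (simp add: real)
  then show ?thesis
    using vector_derivative_unique_at has_vector_derivative_const by blast
qed

section \<open>Derivatives of the curve and their behaviour under the symmetry\<close>

lemma C_holomorphic: "(\<lambda>w. C w $ j) holomorphic_on \<Omega>"
  using ext_C by (simp add: holomorphic_extension_def)

lemma N_holomorphic: "(\<lambda>w. N w $ j) holomorphic_on \<Omega>"
  using ext_N by (simp add: holomorphic_extension_def)

lemma C_of_real: "t \<in> I \<Longrightarrow> C (complex_of_real t) $ j = complex_of_real (c t $ j)"
  using ext_C by (simp add: holomorphic_extension_def)

lemma N_of_real: "t \<in> I \<Longrightarrow> N (complex_of_real t) $ j = complex_of_real (n t $ j)"
  using ext_N by (simp add: holomorphic_extension_def)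

lemma deriv_C_holomorphic: "(\<lambda>w. deriv_vec C w $ j) holomorphic_on \<Omega>"
  by (simp add: deriv_vec_def holomorphic_deriv C_holomorphic open_dom)

text \<open>Reading the derivatives off the holomorphic extension makes their differentiability on
  \<open>I\<close> immediate.\<close>

definition "c' t = Re_vec (deriv_vec C (complex_of_real t))"
definition "c'' t = Re_vec (deriv_vec (deriv_vec C) (complex_of_real t))"

lemma c_has_vector_derivative:
  assumes "t \<in> I"
  shows "(c has_vector_derivative c' t) (at t)"
proof (rule has_vector_derivative_transform_within_open[OF _ open_I assms])
  show "((\<lambda>t. Re_vec (C (1 * complex_of_real t))) has_vector_derivative c' t) (at t)"
    using has_vector_derivative_Re_vec_ray[of \<Omega> C 1 t] C_holomorphic open_dom of_real_dom[OF assms]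
    by (simp add: c'_def)
  show "Re_vec (C (1 * complex_of_real s)) = c s" if "s \<in> I" for s
    by (simp add: vec_eq_iff C_of_real[OF that])
qed

lemma c'_has_vector_derivative:
  assumes "t \<in> I"
  shows "(c' has_vector_derivative c'' t) (at t)"
  using has_vector_derivative_Re_vec_ray[of \<Omega> "deriv_vec C" 1 t]
    deriv_C_holomorphic open_dom of_real_dom[OF assms]
  by (simp add: c'_def[abs_def] c''_def)

lemma vector_derivative_c: "t \<in> I \<Longrightarrow> vector_derivative c (at t) = c' t"
  by (rule vector_derivative_at) (rule c_has_vector_derivative)

lemma c'_nonzero: "t \<in> I \<Longrightarrow> c' t \<noteq> 0"
  using regular vector_derivative_c by (auto simp: regular_on_def)

lemma deriv_C_of_real:
  assumes "t \<in> I"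
  shows "deriv_vec C (complex_of_real t) $ j = complex_of_real (c' t $ j)"
  using Im_deriv_eq_0[OF C_holomorphic[of j] _ assms]
  by (simp add: C_of_real c'_def deriv_vec_def complex_eq_iff)

lemma a_nonzero: "a \<noteq> 0"
  using perp by (simp add: perp_symmetric_def)

lemma c'_0_orthogonal: "c' 0 \<bullet> a = 0"
  using perp vector_derivative_c[OF zero_I] by (simp add: perp_symmetric_def)

lemma c_minus: "t \<in> I \<Longrightarrow> c (- t) = reflect_in_line p a (c t)"
  using perp by (simp add: perp_symmetric_def)

text \<open>Differentiate the symmetry relation for \<open>c\<close>: the reversed parameter gives
  the sign, the reflection gives its linear part.\<close>

lemma c'_minus:
  assumes "t \<in> I"
  shows "c' (- t) = - half_turn a (c' t)"
proof -
  have "((c \<circ> uminus) has_vector_derivative - c' (- t)) (at t)"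
    by (intro has_vector_derivative_compose_uminus c_has_vector_derivative minus_I assms)
  moreover have "((\<lambda>s. p + half_turn a (c s - p)) has_vector_derivative half_turn a (c' t)) (at t)"
    using bounded_linear.has_vector_derivative[OF bounded_linear_half_turn,
        of "\<lambda>s. c s - p" "c' t" "at t" a]
      has_vector_derivative_diff_const[of c p "c' t" "at t"] c_has_vector_derivative[OF assms]
    by (simp add: has_vector_derivative_add_const add.commute[of p])
  then have "((c \<circ> uminus) has_vector_derivative half_turn a (c' t)) (at t)"
    by (rule has_vector_derivative_transform_within_open[OF _ open_I assms])
      (simp add: c_minus reflect_in_line_eq)
  ultimately have "- c' (- t) = half_turn a (c' t)"
    using vector_derivative_unique_at by blast
  then show ?thesis
    by (metis minus_minus)
qed

lemma norm_c'_minus: "t \<in> I \<Longrightarrow> norm (c' (- t)) = norm (c' t)"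
  by (simp add: c'_minus norm_half_turn)

text \<open>A second differentiation of the symmetry relation cancels the sign, so at the vertex the
  acceleration is fixed by the half turn and lies along its axis.\<close>

lemma c''_0_parallel: "c'' 0 = ((c'' 0 \<bullet> a) / (a \<bullet> a)) *\<^sub>R a"
proof (rule half_turn_fixed)
  have "((c' \<circ> uminus) has_vector_derivative - c'' 0) (at 0)"
    using has_vector_derivative_compose_uminus[of c' "c'' 0" 0] c'_has_vector_derivative[OF zero_I]
    by simp
  moreover have "((\<lambda>s. - half_turn a (c' s)) has_vector_derivative - half_turn a (c'' 0)) (at 0)"
    using bounded_linear.has_vector_derivative[OF bounded_linear_half_turn
        c'_has_vector_derivative[OF zero_I]]
    by (auto intro!: derivative_eq_intros)
  then have "((c' \<circ> uminus) has_vector_derivative - half_turn a (c'' 0)) (at 0)"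
    by (rule has_vector_derivative_transform_within_open[OF _ open_I zero_I])
      (simp add: c'_minus)
  ultimately have "- c'' 0 = - half_turn a (c'' 0)"
    using vector_derivative_unique_at by blast
  then show "half_turn a (c'' 0) = c'' 0"
    by simp
qed

section \<open>Symmetries of the holomorphic extension of the curve\<close>

lemma Re_C_minus:
  assumes "w \<in> \<Omega>"
  shows "Re_vec (C (- w)) = reflect_in_line p a (Re_vec (C w))"
proof -
  \<comment> \<open>The reflection formula applied to \<open>C w\<close> with the complex-bilinear
    product. Without conjugation it stays holomorphic, and its real coefficients let it commute with
    taking real parts.\<close>
  define R where "R w j = complex_of_real (p $ j)
      + (2 * (\<Sum>k\<in>UNIV. (C w $ k - of_real (p $ k)) * of_real (a $ k)) / of_real (a \<bullet> a))
          * of_real (a $ j)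
      - (C w $ j - of_real (p $ j))" for w and j :: 3
  have eq: "C (- w) $ j = R w j" for j
  proof (rule identity_theorem[OF holomorphic_on_minus _ _ assms])
    show "(\<lambda>w. R w j) holomorphic_on \<Omega>"
      unfolding R_def using a_nonzero by (intro holomorphic_intros C_holomorphic) auto
    fix t assume t: "t \<in> I"
    have "C (- complex_of_real t) $ j = of_real (c (- t) $ j)"
      using C_of_real[OF minus_I[OF t]] by simp
    then show "C (- complex_of_real t) $ j = R (complex_of_real t) j"
      by (simp add: R_def C_of_real[OF t] c_minus[OF t] reflect_in_line_def inner_vec_def)
  qed (rule C_holomorphic)
  have Re_mult_of_real: "Re (z * of_real r) = Re z * r" "Re (z / of_real r) = Re z / r" for z r
    by simp_all
  show ?thesis
    by (simp only: vec_eq_iff Re_vec_nth eq R_def)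
      (simp add: reflect_in_line_def inner_vec_def Re_mult_of_real
        del: of_real_sum of_real_mult)
qed

text \<open>Schwarz reflection: \<open>cnj \<circ> C \<circ> cnj\<close>, taken componentwise, is
  holomorphic and agrees with \<open>C\<close> on the real interval, where \<open>C\<close> is
  real.\<close>

lemma Re_C_cnj:
  assumes "w \<in> \<Omega>"
  shows "Re_vec (C (cnj w)) = Re_vec (C w)"
proof -
  have "(cnj \<circ> (\<lambda>w. C w $ j) \<circ> cnj) w = C w $ j" for j
    by (rule identity_theorem[OF holomorphic_on_compose_cnj_cnj C_holomorphic _ assms])
      (simp_all add: cnj_image_dom C_holomorphic open_dom C_of_real)
  then have "cnj (C (cnj w) $ j) = C w $ j" for j
    by simp
  then have "Re (C (cnj w) $ j) = Re (C w $ j)" for j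
    by (metis complex_cnj(1) complex_surj cnj.sel(1))
  then show ?thesis
    by (simp add: vec_eq_iff)
qed

text \<open>On the imaginary axis negation and conjugation coincide, so the two preceding symmetries
  combine.\<close>

lemma Re_C_ii_fixed:
  assumes "t \<in> I"
  shows "reflect_in_line p a (Re_vec (C (\<i> * complex_of_real t))) = Re_vec (C (\<i> * complex_of_real t))"
  using Re_C_minus[OF ii_dom[OF assms]] Re_C_cnj[OF ii_dom[OF assms]] by simp

section \<open>The product of normal and velocity: direction and parity\<close>

text \<open>The Bjoerling integrand. It extends \<open>\<nu>\<close> holomorphically, so facts about
  \<open>\<nu>\<close> on the interval pass to \<open>V\<close> by the identity theorem.\<close>

definition V :: "complex \<Rightarrow> complex^3" where
  "V z = cross3_complex (N z) (deriv_vec C z)"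

definition \<nu> :: "real \<Rightarrow> real^3" where
  "\<nu> t = cross3 (n t) (c' t)"

lemma V_holomorphic: "(\<lambda>w. V w $ j) holomorphic_on \<Omega>"
  using exhaust_3[of j]
  by (auto simp: V_def cross3_complex_def intro!: holomorphic_intros N_holomorphic deriv_C_holomorphic)

lemma V_of_real: "t \<in> I \<Longrightarrow> V (complex_of_real t) $ j = complex_of_real (\<nu> t $ j)"
  using exhaust_3[of j]
  by (auto simp: V_def \<nu>_def cross3_complex_def cross3_def N_of_real deriv_C_of_real)

lemma plane_equation:
  obtains m d where "m \<noteq> 0" "P = {x. m \<bullet> x = d}"
proof -
  have "affine P" "aff_dim P = 2"
    using perp by (simp_all add: perp_symmetric_def planar_curve_def)
  then show ?thesis
    using that aff_dim_eq_hyperplane[of P] by (auto simp: hull_same)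
qed

text \<open>
  On the real axis \<open>n \<times> c'\<close> is a multiple of the fixed normal of the plane.  Its length is even in
  the parameter, and so is its sign, since the multiple never vanishes on the interval.
\<close>

lemma \<nu>_parallel_even:
  obtains m where "m \<noteq> 0" "m \<bullet> a = 0"
    and "\<And>t. t \<in> I \<Longrightarrow> m \<bullet> c' t = 0"
    and "\<And>t. t \<in> I \<Longrightarrow> \<exists>s. s \<noteq> 0 \<and> \<nu> t = s *\<^sub>R m"
    and "\<And>t. t \<in> I \<Longrightarrow> \<nu> (- t) = \<nu> t"
proof -
  obtain m d where m: "m \<noteq> 0" and P: "P = {x. m \<bullet> x = d}"
    by (rule plane_equation)
  have line: "p + s *\<^sub>R a \<in> P" for s
    using perp by (auto simp: perp_symmetric_def line_through_def)
  have "m \<bullet> a = 0"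
    using line[of 0] line[of 1] by (simp add: P inner_add_right)
  have c_P: "m \<bullet> c t = d" if "t \<in> I" for t
    using perp that by (auto simp: perp_symmetric_def planar_curve_def P)
  have c'_P: "m \<bullet> c' t = 0" if t: "t \<in> I" for t
  proof -
    have "((\<lambda>t. m \<bullet> c t) has_vector_derivative m \<bullet> c' t) (at t)"
      by (rule bounded_linear.has_vector_derivative[OF bounded_linear_inner_right
            c_has_vector_derivative[OF t]])
    then have "((\<lambda>t. d) has_vector_derivative m \<bullet> c' t) (at t)"
      by (rule has_vector_derivative_transform_within_open[OF _ open_I t]) (rule c_P)
    then show ?thesis
      using vector_derivative_unique_at has_vector_derivative_const by blast
  qed
  have n: "norm (n t) = 1" "n t \<bullet> c' t = 0" "m \<bullet> n t = 0" if t: "t \<in> I" for t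
  proof -
    show "norm (n t) = 1" "n t \<bullet> c' t = 0"
      using normal t by (auto simp: unit_principal_normal_def vector_derivative_c)
    have "p + n t \<in> P"
      using normal t line[of 0] by (auto simp: unit_principal_normal_def)
    then show "m \<bullet> n t = 0"
      using line[of 0] by (simp add: P inner_add_right)
  qed
  define s where "s t = (\<nu> t \<bullet> m) / (m \<bullet> m)" for t
  have \<nu>_eq: "\<nu> t = s t *\<^sub>R m" if t: "t \<in> I" for t
  proof -
    \<comment> \<open>The triple product expansion is used twice: the inner product
      \<open>m \<times> \<nu> t\<close> vanishes because \<open>m\<close> is orthogonal to both
      factors of \<open>\<nu> t\<close>, and expanding the outer one then exhibits
      \<open>\<nu> t\<close> as a multiple of \<open>m\<close>.\<close>
    have "cross3 m (cross3 m (\<nu> t)) = 0"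
      using n[OF t] c'_P[OF t] by (simp add: \<nu>_def Lagrange[of m "n t"])
    then have "(m \<bullet> m) *\<^sub>R \<nu> t = (\<nu> t \<bullet> m) *\<^sub>R m"
      by (simp add: Lagrange[of m m] inner_commute)
    then have "(1 / (m \<bullet> m)) *\<^sub>R ((m \<bullet> m) *\<^sub>R \<nu> t) = s t *\<^sub>R m"
      by (simp add: s_def)
    then show ?thesis
      using m by simp
  qed
  have norm_\<nu>: "norm (\<nu> t) = norm (c' t)" if t: "t \<in> I" for t
    using norm_cross[of "n t" "c' t"] n[OF t] by (simp add: \<nu>_def)
  have abs_s: "\<bar>s t\<bar> = norm (c' t) / norm m" if t: "t \<in> I" for t
    using norm_\<nu>[OF t] \<nu>_eq[OF t] m by (simp add: field_simps)
  have s_nonzero: "s t \<noteq> 0" if t: "t \<in> I" for t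
    using abs_s[OF t] c'_nonzero[OF t] m by auto
  \<comment> \<open>On the interval \<open>\<nu>\<close> is the real part of the holomorphic
    \<open>V\<close>. Its continuity makes the range of the multiplier \<open>s\<close> an interval,
    which would contain 0 if the sign changed.\<close>
  have "continuous_on I \<nu>"
  proof (rule continuous_at_imp_continuous_on, rule ballI)
    fix t assume t: "t \<in> I"
    have "((\<lambda>t. Re_vec (V (1 * complex_of_real t))) has_vector_derivative
        Re_vec (\<chi> j. 1 * deriv_vec V (1 * complex_of_real t) $ j)) (at t)"
      by (rule has_vector_derivative_Re_vec_ray[OF open_dom V_holomorphic]) (simp add: of_real_dom t)
    then have "(\<nu> has_vector_derivative Re_vec (\<chi> j. 1 * deriv_vec V (1 * complex_of_real t) $ j)) (at t)"
      by (rule has_vector_derivative_transform_within_open[OF _ open_I t])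
        (simp add: vec_eq_iff V_of_real)
    then show "isCont \<nu> t"
      by (rule has_vector_derivative_continuous)
  qed
  then have cont_s: "continuous_on I s"
    unfolding s_def using m by (intro continuous_intros) auto
  have "s (- t) = s t" if t: "t \<in> I" for t
  proof -
    have "connected (s ` I)"
      using cont_s interval_I by (intro connected_continuous_image is_interval_connected)
    then have conv: "is_interval (s ` I)"
      by (simp add: is_interval_connected_1)
    have "sgn (s (- t)) = sgn (s t)"
    proof (rule ccontr)
      assume "sgn (s (- t)) \<noteq> sgn (s t)"
      then have "s (- t) \<le> 0 \<and> 0 \<le> s t \<or> s t \<le> 0 \<and> 0 \<le> s (- t)"
        by (auto simp: sgn_real_def split: if_splits)
      then have "0 \<in> s ` I"
        using conv t minus_I[OF t] unfolding is_interval_1 by blast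
      then show False
        using s_nonzero by fastforce
    qed
    moreover have "\<bar>s (- t)\<bar> = \<bar>s t\<bar>"
      using abs_s t minus_I[OF t] norm_c'_minus by simp
    ultimately show ?thesis
      by (metis sgn_mult_abs)
  qed
  then show ?thesis
    using that[OF m \<open>m \<bullet> a = 0\<close>] \<nu>_eq c'_P s_nonzero minus_I by metis
qed

lemma V_even:
  assumes "w \<in> \<Omega>"
  shows "V (- w) $ j = V w $ j"
proof (rule identity_theorem[OF holomorphic_on_minus _ _ assms])
  show "V (- complex_of_real t) $ j = V (complex_of_real t) $ j" if t: "t \<in> I" for t
    using V_of_real[OF t] V_of_real[OF minus_I[OF t]] \<nu>_parallel_even t
    by (metis of_real_minus)
qed (rule V_holomorphic)+

section \<open>The primitive of the integrand: parity and direction\<close>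

definition G :: "complex \<Rightarrow> complex^3" where
  "G w = (\<chi> j. integral_from_0 \<Omega> (\<lambda>z. V z $ j) w)"

lemma G_0: "G 0 = 0"
  using integral_from_0_primitive(1)[OF open_dom simply_connected_dom zero_dom V_holomorphic]
  by (simp add: G_def vec_eq_iff)

lemma G_deriv: "w \<in> \<Omega> \<Longrightarrow> ((\<lambda>w. G w $ j) has_field_derivative V w $ j) (at w)"
  using integral_from_0_primitive(2)[OF open_dom simply_connected_dom zero_dom V_holomorphic]
  by (simp add: G_def)

text \<open>Turns identities for \<open>V\<close> into identities for its primitive
  \<open>G\<close>, the normalization at 0 fixing the constant.\<close>

lemma eq_0_of_deriv_0:
  assumes "\<And>w. w \<in> \<Omega> \<Longrightarrow> (f has_field_derivative 0) (at w)" "f 0 = 0" "w \<in> \<Omega>"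
  shows "f w = 0"
  using has_field_derivative_0_imp_constant_on[OF assms(1) connected_dom open_dom] assms(2,3) zero_dom
  by (metis constant_on_def)

text \<open>The sum \<open>G w + G (- w)\<close> has derivative \<open>V w - V (- w)\<close>, which
  is 0 because \<open>V\<close> is even.\<close>

lemma G_odd:
  assumes "w \<in> \<Omega>"
  shows "G (- w) = - G w"
proof -
  have "G w $ j + G (- w) $ j = 0" for j
  proof (rule eq_0_of_deriv_0[where f = "\<lambda>w. G w $ j + G (- w) $ j", OF _ _ assms])
    fix w assume w: "w \<in> \<Omega>"
    have "((\<lambda>w. G (- w) $ j) has_field_derivative V (- w) $ j * (- 1)) (at w)"
      by (rule DERIV_chain2[where f = "\<lambda>w. G w $ j" and g = uminus, OF G_deriv[OF minus_dom[OF w]]])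
        (auto intro!: derivative_eq_intros)
    from DERIV_add[OF G_deriv[OF w, of j] this]
    show "((\<lambda>w. G w $ j + G (- w) $ j) has_field_derivative 0) (at w)"
      by (simp add: V_even[OF w])
  qed (simp add: G_0)
  then show ?thesis
    by (simp add: vec_eq_iff eq_neg_iff_add_eq_0 add.commute)
qed

text \<open>Orthogonality of a real vector to \<open>\<nu>\<close> extends to \<open>V\<close> by
  the identity theorem and then to \<open>G\<close> by integration. It is applied to the axis
  \<open>a\<close> and to the velocity \<open>c' 0\<close>.\<close>

lemma G_orthogonal:
  assumes q: "\<And>t. t \<in> I \<Longrightarrow> q \<bullet> \<nu> t = 0" and "w \<in> \<Omega>"
  shows "q \<bullet> Re_vec (- \<i> *s G w) = 0"
proof -
  have V0: "(\<Sum>j\<in>UNIV. of_real (q $ j) * V w $ j) = 0" if w: "w \<in> \<Omega>" for w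
  proof (rule identity_theorem[OF _ _ _ w, of _ "\<lambda>w. 0"])
    show "(\<lambda>w. \<Sum>j\<in>UNIV. complex_of_real (q $ j) * V w $ j) holomorphic_on \<Omega>"
      by (intro holomorphic_intros V_holomorphic)
    fix t assume t: "t \<in> I"
    have "(\<Sum>j\<in>UNIV. complex_of_real (q $ j) * V (complex_of_real t) $ j) = of_real (q \<bullet> \<nu> t)"
      by (simp add: V_of_real[OF t] inner_vec_def)
    then show "(\<Sum>j\<in>UNIV. complex_of_real (q $ j) * V (complex_of_real t) $ j) = 0"
      by (simp add: q[OF t])
  qed simp
  have "(\<Sum>j\<in>UNIV. of_real (q $ j) * G w $ j) = 0"
  proof (rule eq_0_of_deriv_0[where f = "\<lambda>w. \<Sum>j\<in>UNIV. of_real (q $ j) * G w $ j", OF _ _ \<open>w \<in> \<Omega>\<close>])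
    fix w assume w: "w \<in> \<Omega>"
    have "((\<lambda>w. \<Sum>j\<in>UNIV. of_real (q $ j) * G w $ j) has_field_derivative
        (\<Sum>j\<in>UNIV. of_real (q $ j) * V w $ j)) (at w)"
      by (intro DERIV_sum DERIV_cmult G_deriv w)
    then show "((\<lambda>w. \<Sum>j\<in>UNIV. of_real (q $ j) * G w $ j) has_field_derivative 0) (at w)"
      by (simp only: V0[OF w])
  qed (simp add: G_0)
  \<comment> \<open>The real part of \<open>- \<i> * z\<close> is the imaginary part of
    \<open>z\<close>.\<close>
  then have "Im (\<Sum>j\<in>UNIV. of_real (q $ j) * G w $ j) = 0"
    by simp
  then show ?thesis
    by (simp add: inner_vec_def)
qed

section \<open>The Bjoerling surface and its curve over the imaginary axis\<close>

text \<open>The holomorphic curve whose real part is the surface; the lemmas on rays apply to it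
  directly.\<close>

definition B :: "complex \<Rightarrow> complex^3" where
  "B w = C w - \<i> *s G w"

lemma bjoerling_eq: "bjoerling \<Omega> C N w = Re_vec (B w)"
  by (simp add: bjoerling_def B_def G_def V_def vec_eq_iff)

lemma B_deriv:
  assumes "w \<in> \<Omega>"
  shows "((\<lambda>w. B w $ j) has_field_derivative deriv_vec C w $ j - \<i> * V w $ j) (at w)"
  using DERIV_diff[OF holomorphic_derivI[OF C_holomorphic[of j] open_dom assms]
      DERIV_cmult[OF G_deriv[OF assms, of j], of \<i>]]
  by (simp add: B_def deriv_vec_def)

lemma B_holomorphic: "(\<lambda>w. B w $ j) holomorphic_on \<Omega>"
  using B_deriv open_dom by (auto simp: holomorphic_on_open)

definition c_hat :: "real \<Rightarrow> real^3" where
  "c_hat t = bjoerling \<Omega> C N (\<i> * complex_of_real t)"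

text \<open>The factor \<open>\<i>\<close> from the ray multiplies the derivative
  \<open>C' - \<i> * V\<close> of \<open>B\<close>, so that \<open>V\<close> appears without a
  factor.\<close>

definition c_hat' :: "real \<Rightarrow> real^3" where
  "c_hat' t = Re_vec (\<i> *s deriv_vec C (\<i> * complex_of_real t) + V (\<i> * complex_of_real t))"

lemma c_hat_eq:
  "c_hat t = Re_vec (C (\<i> * complex_of_real t)) + Re_vec (- \<i> *s G (\<i> * complex_of_real t))"
  by (simp add: c_hat_def bjoerling_eq B_def vec_eq_iff)

lemma c_hat_has_vector_derivative:
  assumes "t \<in> I"
  shows "(c_hat has_vector_derivative c_hat' t) (at t)"
proof -
  have "deriv_vec B (\<i> * complex_of_real t) $ j
      = deriv_vec C (\<i> * complex_of_real t) $ j - \<i> * V (\<i> * complex_of_real t) $ j" for j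
    using DERIV_imp_deriv[OF B_deriv[OF ii_dom[OF assms]]] by (simp add: deriv_vec_def)
  then have "Re_vec (\<chi> j. \<i> * deriv_vec B (\<i> * complex_of_real t) $ j) = c_hat' t"
    by (simp add: c_hat'_def vec_eq_iff)
  then show ?thesis
    using has_vector_derivative_Re_vec_ray[OF open_dom B_holomorphic ii_dom[OF assms]]
    by (simp add: c_hat_def[abs_def] bjoerling_eq)
qed

text \<open>At 0 the extended velocity is real, so its multiple by \<open>\<i>\<close> has no real
  part, while \<open>V\<close> is real there.\<close>

lemma c_hat'_0: "c_hat' 0 = \<nu> 0"
  using deriv_C_of_real[OF zero_I] V_of_real[OF zero_I] by (simp add: c_hat'_def vec_eq_iff)

text \<open>
  The integral contributes nothing to the second derivative at the vertex, because its integrand is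
  real on the real axis.
\<close>

lemma c_hat'_has_vector_derivative_0: "(c_hat' has_vector_derivative - c'' 0) (at 0)"
proof -
  let ?K = "\<lambda>w. \<i> *s deriv_vec C w + V w"
  have hol: "(\<lambda>w. ?K w $ j) holomorphic_on \<Omega>" for j
    by (simp add: holomorphic_on_add holomorphic_on_mult deriv_C_holomorphic V_holomorphic)
  have K': "deriv_vec ?K 0 $ j = \<i> * deriv_vec (deriv_vec C) 0 $ j + deriv (\<lambda>w. V w $ j) 0" for j
    using DERIV_imp_deriv[OF DERIV_add[OF
          DERIV_cmult[OF holomorphic_derivI[OF deriv_C_holomorphic open_dom zero_dom]]
          holomorphic_derivI[OF V_holomorphic open_dom zero_dom]]]
    by (simp add: deriv_vec_def)
  have "Im (deriv (\<lambda>w. V w $ j) 0) = 0" for j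
    using Im_deriv_eq_0[OF V_holomorphic[of j] _ zero_I] by (simp add: V_of_real)
  then have "Re_vec (\<chi> j. \<i> * deriv_vec ?K (\<i> * complex_of_real 0) $ j) = - c'' 0"
    by (simp add: vec_eq_iff K' c''_def)
  then show ?thesis
    using has_vector_derivative_Re_vec_ray[OF open_dom hol ii_dom[OF zero_I]]
    by (simp add: c_hat'_def[abs_def])
qed

section \<open>Symmetry and non-degeneracy of the new curve\<close>

lemma \<nu>_orthogonal_a: "t \<in> I \<Longrightarrow> a \<bullet> \<nu> t = 0"
  by (rule \<nu>_parallel_even) (metis inner_commute inner_scaleR_right mult_zero_right)

lemma \<nu>_orthogonal_c'_0: "t \<in> I \<Longrightarrow> c' 0 \<bullet> \<nu> t = 0"
  by (rule \<nu>_parallel_even) (metis inner_commute inner_scaleR_right mult_zero_right zero_I)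

lemma \<nu>_0_nonzero: "\<nu> 0 \<noteq> 0"
  by (rule \<nu>_parallel_even) (metis scaleR_eq_0_iff zero_I)

lemma Re_C_ii_in_line: "t \<in> I \<Longrightarrow> Re_vec (C (\<i> * complex_of_real t)) \<in> line_through p a"
  by (intro reflect_in_line_fixed Re_C_ii_fixed)

text \<open>The old velocity at the vertex is normal to the new plane: it is orthogonal both to the
  line and to \<open>\<nu>\<close>, the two directions in which the new curve moves.\<close>

theorem perp_symmetric_c_hat: "perp_symmetric I {x. c' 0 \<bullet> x = c' 0 \<bullet> p} p a c_hat"
  unfolding perp_symmetric_def planar_curve_def
proof (intro conjI ballI)
  let ?P' = "{x. c' 0 \<bullet> x = c' 0 \<bullet> p}"
  have c'_a: "c' 0 \<bullet> a = 0"
    by (rule c'_0_orthogonal)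
  show line: "line_through p a \<subseteq> ?P'"
    by (auto simp: line_through_def inner_add_right c'_a)
  show "real_analytic_on I c_hat"
    using real_analytic_on_Re_vec_ray[of \<Omega> B \<i> I] open_dom B_holomorphic ii_dom
    by (simp add: c_hat_def[abs_def] bjoerling_eq)
  show "affine ?P'"
    by (rule affine_hyperplane)
  show "aff_dim ?P' = 2"
    using c'_nonzero[OF zero_I] by simp
  have orth: "q \<bullet> Re_vec (- \<i> *s G (\<i> * complex_of_real t)) = 0"
    if "\<And>t. t \<in> I \<Longrightarrow> q \<bullet> \<nu> t = 0" "t \<in> I" for q t
    by (rule G_orthogonal[OF that(1) ii_dom[OF that(2)]])
  show "c_hat ` I \<subseteq> ?P'"
  proof (rule image_subsetI)
    fix t assume t: "t \<in> I"
    have "Re_vec (C (\<i> * complex_of_real t)) \<in> ?P'"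
      using Re_C_ii_in_line[OF t] line by blast
    then show "c_hat t \<in> ?P'"
      using orth[OF \<nu>_orthogonal_c'_0 t] by (simp add: c_hat_eq inner_add_right)
  qed
  show "a \<noteq> 0"
    by (rule a_nonzero)
  show "reflect_in_line p a (c_hat t) = c_hat (- t)" if t: "t \<in> I" for t
  proof -
    \<comment> \<open>Split the point into \<open>x\<close> on the line, which is even in
      \<open>t\<close>, and \<open>y\<close> orthogonal to the line, which is odd in
      \<open>t\<close>. Reflection fixes the first and negates the second, just as reversing the
      parameter does.\<close>
    define x where "x = Re_vec (C (\<i> * complex_of_real t))"
    define y where "y = Re_vec (- \<i> *s G (\<i> * complex_of_real t))"
    have x: "reflect_in_line p a x = x"
      unfolding x_def by (rule Re_C_ii_fixed[OF t])
    have y: "half_turn a y = - y"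
      using orth[OF \<nu>_orthogonal_a t] by (intro half_turn_orthogonal) (simp add: y_def inner_commute)
    have "Re_vec (C (\<i> * complex_of_real (- t))) = x"
      using Re_C_minus[OF ii_dom[OF t]] x by (simp add: x_def)
    moreover have "Re_vec (- \<i> *s G (\<i> * complex_of_real (- t))) = - y"
      using G_odd[OF ii_dom[OF t]] by (simp add: y_def vec_eq_iff)
    ultimately have "c_hat (- t) = x - y"
      by (simp only: c_hat_eq) simp
    moreover have "reflect_in_line p a (x + y) = reflect_in_line p a x + half_turn a y"
      using linear_add[OF bounded_linear.linear[OF bounded_linear_half_turn], of a "x - p" y]
      by (simp add: reflect_in_line_eq algebra_simps)
    ultimately show ?thesis
      using x y by (simp only: c_hat_eq x_def[symmetric] y_def[symmetric]) simp
  qed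
  show "0 \<in> I"
    by (rule zero_I)
  show "c_hat 0 \<in> line_through p a"
    using Re_C_ii_in_line[OF zero_I] by (simp add: c_hat_eq G_0 Re_vec_def zero_vec_def[symmetric])
  show "vector_derivative c_hat (at 0) \<bullet> a = 0"
    using vector_derivative_at[OF c_hat_has_vector_derivative[OF zero_I]] \<nu>_orthogonal_a[OF zero_I]
    by (simp add: c_hat'_0 inner_commute)
qed

text \<open>Both accelerations at the vertex are multiples of \<open>a\<close>, hence orthogonal to
  the velocities \<open>c' 0\<close> and \<open>\<nu> 0\<close>. The curvature vectors are therefore
  \<open>c'' 0\<close> and \<open>- c'' 0\<close> up to positive factors.\<close>

theorem nondegenerate_c_hat:
  assumes "nondegenerate c"
  shows "nondegenerate c_hat"
proof -
  obtain r where r: "c'' 0 = r *\<^sub>R a"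
    using c''_0_parallel by metis
  have "curvature_vector c 0 = c'' 0 /\<^sub>R (norm (c' 0))\<^sup>2"
    by (rule curvature_vector_eq[OF open_I zero_I c_has_vector_derivative
          c'_has_vector_derivative[OF zero_I] c'_nonzero[OF zero_I]])
      (simp_all add: r c'_0_orthogonal)
  moreover have "curvature_vector c_hat 0 = - c'' 0 /\<^sub>R (norm (c_hat' 0))\<^sup>2"
    by (rule curvature_vector_eq[OF open_I zero_I c_hat_has_vector_derivative
          c_hat'_has_vector_derivative_0])
      (simp_all add: c_hat'_0 \<nu>_0_nonzero r inner_commute[of "\<nu> 0"] \<nu>_orthogonal_a[OF zero_I])
  ultimately show ?thesis
    using assms \<nu>_0_nonzero by (auto simp: nondegenerate_def c_hat'_0)
qed

end

section \<open>Regularity away from branch points, and the combined result\<close>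

text \<open>The velocity is the image of the nonzero direction \<open>u\<close> under the
  differential of \<open>X\<close>, so it can vanish only where that differential fails to be
  injective.\<close>

lemma regular_on_immersed_ray:
  assumes "u \<noteq> 0"
  shows "regular_on {t \<in> I. immersed_at X (u * complex_of_real t)} (\<lambda>t. X (u * complex_of_real t))"
  unfolding regular_on_def
proof
  fix t assume "t \<in> {t \<in> I. immersed_at X (u * complex_of_real t)}"
  then have im: "immersed_at X (u * complex_of_real t)"
    by simp
  let ?D = "frechet_derivative X (at (u * complex_of_real t))"
  have D: "(X has_derivative ?D) (at (u * complex_of_real t))" and inj: "inj ?D"
    using im frechet_derivative_works by (auto simp: immersed_at_def)
  then have lin: "linear ?D"
    using has_derivative_linear by blast
  have "((\<lambda>t. u * complex_of_real t) has_vector_derivative u) (at t)"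
    by (auto intro!: derivative_eq_intros)
  then have "((\<lambda>t. X (u * complex_of_real t)) has_derivative (\<lambda>h. ?D (h *\<^sub>R u))) (at t)"
    unfolding has_vector_derivative_def by (rule has_derivative_compose[where g = X]) (rule D)
  then have "((\<lambda>t. X (u * complex_of_real t)) has_vector_derivative ?D u) (at t)"
    by (simp add: has_vector_derivative_def linear_cmul[OF lin])
  then have "vector_derivative (\<lambda>t. X (u * complex_of_real t)) (at t) = ?D u"
    by (rule vector_derivative_at)
  then show "vector_derivative (\<lambda>t. X (u * complex_of_real t)) (at t) \<noteq> 0"
    using inj linear_injective_0[OF lin] assms by auto
qed

theorem lemma2p6:
  fixes I :: "real set" and \<Omega> :: "complex set"
    and P :: "(real^3) set" and p a :: "real^3"
    and c n c_hat :: "real \<Rightarrow> real^3"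
    and C N :: "complex \<Rightarrow> complex^3"
    and X :: "complex \<Rightarrow> real^3"
  assumes "open I" and "is_interval I" and "I \<noteq> {}" and "uminus ` I = I"
    and "open \<Omega>" and "simply_connected \<Omega>" and "complex_of_real ` I \<subseteq> \<Omega>"
    and "cnj ` \<Omega> = \<Omega>" and "(\<lambda>w. \<i> * w) ` \<Omega> = \<Omega>"
    and "perp_symmetric I P p a c" and "regular_on I c"
    and "unit_principal_normal I P c n"
    and "holomorphic_extension I \<Omega> c C" and "holomorphic_extension I \<Omega> n N"
    and "X = bjoerling \<Omega> C N"
    and "c_hat = (\<lambda>t. X (\<i> * complex_of_real t))"
  shows "(\<exists>P' p' a'. perp_symmetric I P' p' a' c_hat)
    \<and> regular_on {t \<in> I. immersed_at X (\<i> * complex_of_real t)} c_hat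
    \<and> (nondegenerate c \<longrightarrow> nondegenerate c_hat)"
proof -
  interpret bjoerling_setting I \<Omega> P p a c n C N
    using assms(1,2,4-14) by unfold_locales
  have "c_hat = bjoerling_setting.c_hat \<Omega> C N"
    using assms(15,16) by (simp add: fun_eq_iff c_hat_def)
  then show ?thesis
    using perp_symmetric_c_hat nondegenerate_c_hat regular_on_immersed_ray[of \<i> I X] assms(16)
    by auto
qed

end
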